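(* Let $n,p$ be positive integers with $n>1$, and let $Q=2p$. Then \[ A_{p,p}(Q^n-1)=\begin{cases} Q^n, & \text{if } n \text{ is odd},\\ Q^n+Q, & \text{if } n \text{ is even and } p>1,\\ Q^n+Q+2, & \text{if } n \text{ is even and } p=1. \end{cases} \]
   Context: For positive integers $p,q$, let $\theta_{p,q}$ be the generalised Thue--Morse substitution on $\{0,1\}$, $\theta_{p,q}\colon 0\mapsto 0^p1^q,\ 1\mapsto 1^p0^q$ (extended to words by concatenation), and let $v=v_0v_1v_2\dots=\lim_{n\to\infty}\theta_{p,q}^n(0)\in\{0,1\}^{\mathbb{N}}$ be the generalised Thue--Morse word, indexed from $0$. For positive integers $d,L$, a monochromatic arithmetic progression of difference $d$ and length $L$ in $v$ means that there is $i\ge 0$ with $v_i=v_{i+d}=\dots=v_{i+(L-1)d}$. $A_{p,q}(d)$ denotes the maximum length $L$ of a monochromatic arithmetic progression of difference $d$ in $v$ (this maximum exists and is finite for every $d\geq 1$); $A_{p,p}$ is the case $q=p$. *)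

theory Defs
  imports Complex_Main
begin

(* The alphabet {0,1} is bool, with 0 = False and 1 = True. *)

definition gtm_letter :: "nat \<Rightarrow> nat \<Rightarrow> bool \<Rightarrow> bool list" where
  "gtm_letter p q a =
     (if a then replicate p True @ replicate q False
      else replicate p False @ replicate q True)"

definition gtm_subst :: "nat \<Rightarrow> nat \<Rightarrow> bool list \<Rightarrow> bool list" where
  "gtm_subst p q w = concat (map (gtm_letter p q) w)"

(* Coordinatewise limit of the finite words obtained by iterating the substitution on 0:
   letter k is the letter that eventually stands at position k. It is unique whenever
   it exists; existence for p, q > 0 is gtm_word_nth. *)
definition gtm_word :: "nat \<Rightarrow> nat \<Rightarrow> nat \<Rightarrow> bool" where
  "gtm_word p q k =
     (THE a. \<forall>\<^sub>F n in sequentially.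
        k < length ((gtm_subst p q ^^ n) [False]) \<and> (gtm_subst p q ^^ n) [False] ! k = a)"

definition has_mono_ap :: "(nat \<Rightarrow> bool) \<Rightarrow> nat \<Rightarrow> nat \<Rightarrow> bool" where
  "has_mono_ap v d L \<longleftrightarrow> (\<exists>i. \<forall>j<L. v (i + j * d) = v i)"

(* Max is unspecified on infinite sets, so an equation for A p q d also
   relies on the set of lengths being finite. *)
definition A :: "nat \<Rightarrow> nat \<Rightarrow> nat \<Rightarrow> nat" where
  "A p q d = Max {L. L \<ge> 1 \<and> has_mono_ap (gtm_word p q) d L}"

lemma gtm_subst_append: "gtm_subst p q (u @ w) = gtm_subst p q u @ gtm_subst p q w"
  by (simp add: gtm_subst_def)

lemma length_gtm_subst: "length (gtm_subst p q w) = (p + q) * length w"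
  by (induction w) (auto simp: gtm_subst_def gtm_letter_def)

lemma length_gtm_iterate: "length ((gtm_subst p q ^^ n) [False]) = (p + q) ^ n"
  by (induction n) (simp_all add: length_gtm_subst)

lemma gtm_iterate_prefix_Suc:
  assumes "p > 0"
  shows "\<exists>w. (gtm_subst p q ^^ Suc n) [False] = (gtm_subst p q ^^ n) [False] @ w"
proof (induction n)
  case 0
  obtain p' where "p = Suc p'" using assms by (cases p) auto
  then show ?case by (simp add: gtm_subst_def gtm_letter_def)
next
  case (Suc n)
  then obtain w where "(gtm_subst p q ^^ Suc n) [False] = (gtm_subst p q ^^ n) [False] @ w"
    by blast
  then have "gtm_subst p q ((gtm_subst p q ^^ Suc n) [False]) =
      gtm_subst p q ((gtm_subst p q ^^ n) [False] @ w)"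
    by (rule arg_cong)
  also have "\<dots> = (gtm_subst p q ^^ Suc n) [False] @ gtm_subst p q w"
    by (simp add: gtm_subst_append)
  finally have "(gtm_subst p q ^^ Suc (Suc n)) [False] =
      (gtm_subst p q ^^ Suc n) [False] @ gtm_subst p q w"
    by (subst funpow.simps(2)) (subst comp_apply)
  then show ?case by (rule exI)
qed

lemma gtm_iterate_prefix:
  assumes "p > 0" "m \<le> n"
  shows "\<exists>w. (gtm_subst p q ^^ n) [False] = (gtm_subst p q ^^ m) [False] @ w"
  using assms(2)
proof (induction n rule: dec_induct)
  case base
  then show ?case by simp
next
  case (step n)
  then obtain u where u: "(gtm_subst p q ^^ n) [False] = (gtm_subst p q ^^ m) [False] @ u"
    by blast
  obtain w where "(gtm_subst p q ^^ Suc n) [False] = (gtm_subst p q ^^ n) [False] @ w"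
    using gtm_iterate_prefix_Suc[OF assms(1)] by blast
  then have "(gtm_subst p q ^^ Suc n) [False] = (gtm_subst p q ^^ m) [False] @ (u @ w)"
    by (simp only: u append_assoc)
  then show ?case by blast
qed

lemma gtm_word_nth:
  assumes "p > 0" "q > 0" "k < (p + q) ^ n"
  shows "gtm_word p q k = (gtm_subst p q ^^ n) [False] ! k"
proof -
  let ?w = "\<lambda>m. (gtm_subst p q ^^ m) [False]"
  have stable: "k < length (?w m) \<and> ?w m ! k = ?w n ! k" if mn: "m \<ge> n" for m
  proof -
    obtain u where "?w m = ?w n @ u"
      using gtm_iterate_prefix[OF assms(1) mn] by blast
    then show ?thesis
      using assms(3) by (simp add: length_gtm_iterate nth_append)
  qed
  show ?thesis
    unfolding gtm_word_def
  proof (rule the_equality)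
    show "\<forall>\<^sub>F m in sequentially. k < length (?w m) \<and> ?w m ! k = ?w n ! k"
      unfolding eventually_sequentially using stable by blast
  next
    fix a
    assume "\<forall>\<^sub>F m in sequentially. k < length (?w m) \<and> ?w m ! k = a"
    then obtain N where "\<forall>m\<ge>N. ?w m ! k = a"
      unfolding eventually_sequentially by blast
    then have "?w (max n N) ! k = a"
      by (meson max.cobounded2)
    moreover have "?w (max n N) ! k = ?w n ! k"
      using stable[OF max.cobounded1] by (rule conjunct2)
    ultimately show "a = ?w n ! k"
      by (rule subst)
  qed
qed

end

theory Submission
  imports Defs
begin

text \<open>
  Put \<open>N = Q ^ n\<close>. The letter at \<open>k\<close> is the parity of the number of base-\<open>Q\<close> digits of \<open>k\<close> that are
  at least \<open>p\<close>. Adding \<open>N - 1\<close> to \<open>k * N + x\<close> with \<open>x > 0\<close> increments \<open>k\<close> and decrements \<open>x\<close>,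
  so a progression compares the word, read backwards from below \<open>N\<close>, with a window read forwards;
  complementing digits turns the backward reading into a forward one.
  For odd \<open>n\<close> the letter changes whenever \<open>x\<close> passes from \<open>0\<close> to \<open>N - 1\<close>, which
  bounds the length by \<open>N\<close>. For even \<open>n\<close> put \<open>e = p\<close> if \<open>p > 1\<close> and \<open>e = 2\<close> if \<open>p = 1\<close>.
  The letter changes at residue \<open>N - e\<close> and at residue \<open>e\<close> unless \<open>k + 1\<close> is divisible by \<open>p\<close>
  (by \<open>2\<close> if \<open>p = 1\<close>). Consecutive sweeps through the residues cannot both be exceptional,
  so at most one full sweep and \<open>e\<close> terms on either side of it are monochromatic.
\<close>

section \<open>Letters of the word in terms of digits\<close>

lemma gtm_subst_nth:
  assumes "k < length w" "r < p + q"
  shows "gtm_subst p q w ! ((p + q) * k + r) = (w ! k \<noteq> (p \<le> r))"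
  using assms(1)
proof (induction w arbitrary: k)
  case (Cons a w)
  have len: "length (gtm_letter p q a) = p + q"
    by (simp add: gtm_letter_def)
  have letter: "gtm_letter p q a ! r = (a \<noteq> (p \<le> r))"
    using assms(2) by (simp add: gtm_letter_def nth_append less_diff_conv2 add.commute)
  have sub: "gtm_subst p q (a # w) = gtm_letter p q a @ gtm_subst p q w"
    by (simp add: gtm_subst_def)
  show ?case
  proof (cases k)
    case 0
    then show ?thesis
      using assms(2) by (simp add: sub nth_append len letter)
  next
    case (Suc k')
    then show ?thesis
      using Cons by (simp add: sub nth_append len)
  qed
qed simp

lemma gtm_word_digit:
  assumes "p > 0" "q > 0" "r < p + q"
  shows "gtm_word p q ((p + q) * k + r) = (gtm_word p q k \<noteq> (p \<le> r))"
proof -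
  \<comment> \<open>The \<open>k\<close>-th iterate is long enough to contain position
    \<open>k\<close>, so the next iterate contains the whole image of that letter.\<close>
  have k: "k < (p + q) ^ k"
    using assms by (intro power_gt_expt) auto
  have "(p + q) * k + r < (p + q) * Suc k"
    using assms by simp
  also have "\<dots> \<le> (p + q) ^ Suc k"
    using k by (simp del: mult_Suc_right)
  finally have "gtm_word p q ((p + q) * k + r) =
      gtm_subst p q ((gtm_subst p q ^^ k) [False]) ! ((p + q) * k + r)"
    using gtm_word_nth[OF assms(1,2), of _ "Suc k"] by simp
  also have "\<dots> = (gtm_word p q k \<noteq> (p \<le> r))"
    using gtm_subst_nth[of k "(gtm_subst p q ^^ k) [False]" r p q] k assms
    by (simp add: length_gtm_iterate gtm_word_nth[OF assms(1,2) k])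
  finally show ?thesis .
qed

lemma gtm_word_0:
  assumes "p > 0" "q > 0"
  shows "\<not> gtm_word p q 0"
  using gtm_word_nth[OF assms, of 0 0] by simp

text \<open>The digits of \<open>k * (p + q) ^ n + r\<close> are those of \<open>k\<close> followed
  by \<open>n\<close> digits of \<open>r\<close>, so the parities add. The induction peels off the
  lowest digit.\<close>

lemma gtm_word_block:
  assumes "p > 0" "q > 0" "r < (p + q) ^ n"
  shows "gtm_word p q (k * (p + q) ^ n + r) = (gtm_word p q k \<noteq> gtm_word p q r)"
  using assms(3)
proof (induction n arbitrary: r)
  case 0
  then show ?case using gtm_word_0[OF assms(1,2)] by simp
next
  case (Suc n)
  define a b where "a = r div (p + q)" and "b = r mod (p + q)"
  have r: "r = (p + q) * a + b" and b: "b < p + q"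
    using assms by (simp_all add: a_def b_def)
  have a: "a < (p + q) ^ n"
    unfolding a_def using Suc.prems assms by (simp add: less_mult_imp_div_less mult.commute)
  have eq: "k * (p + q) ^ Suc n + r = (p + q) * (k * (p + q) ^ n + a) + b"
    by (simp add: r algebra_simps)
  have "gtm_word p q (k * (p + q) ^ Suc n + r) = ((gtm_word p q k \<noteq> gtm_word p q a) \<noteq> (p \<le> b))"
    unfolding eq gtm_word_digit[OF assms(1,2) b] Suc.IH[OF a] ..
  moreover have "gtm_word p q r = (gtm_word p q a \<noteq> (p \<le> b))"
    unfolding r by (rule gtm_word_digit[OF assms(1,2) b])
  ultimately show ?case by blast
qed

text \<open>Subtracting from \<open>(2 * p) ^ n - 1\<close> replaces each of the \<open>n\<close>
  digits \<open>b\<close> by \<open>2 * p - 1 - b\<close>, and exactly one of the two is at least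
  \<open>p\<close>: the parity is flipped \<open>n\<close> times.\<close>

lemma gtm_word_reflect:
  assumes "p > 0" "r < (2 * p) ^ n"
  shows "gtm_word p p ((2 * p) ^ n - 1 - r) = (gtm_word p p r \<noteq> odd n)"
  using assms(2)
proof (induction n arbitrary: r)
  case 0
  then show ?case by simp
next
  case (Suc n)
  define a b where "a = r div (2 * p)" and "b = r mod (2 * p)"
  have r: "r = (p + p) * a + b" and b: "b < p + p"
    using assms by (simp_all add: a_def b_def flip: mult_2)
  have a: "a < (2 * p) ^ n"
    unfolding a_def using Suc.prems assms by (simp add: less_mult_imp_div_less mult.commute)
  define c where "c = (2 * p) ^ n - 1 - a"
  have N: "(2 * p) ^ n = c + a + 1"
    using a by (simp add: c_def)
  have "(2 * p) ^ Suc n = (p + p) * (c + a + 1)"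
    by (simp only: power_Suc N flip: mult_2)
  then have eq: "(2 * p) ^ Suc n - 1 - r = (p + p) * c + (p + p - 1 - b)"
    using b by (simp add: r algebra_simps)
  have "gtm_word p p ((2 * p) ^ Suc n - 1 - r) = (gtm_word p p c \<noteq> (p \<le> p + p - 1 - b))"
    unfolding eq using assms b by (intro gtm_word_digit) auto
  moreover have "gtm_word p p r = (gtm_word p p a \<noteq> (p \<le> b))"
    unfolding r by (rule gtm_word_digit[OF assms(1) assms(1) b])
  moreover have "gtm_word p p c = (gtm_word p p a \<noteq> odd n)"
    unfolding c_def by (rule Suc.IH[OF a])
  moreover have "(p \<le> p + p - 1 - b) \<longleftrightarrow> \<not> p \<le> b"
    using b by auto
  ultimately show ?case by auto
qed

text \<open>The last digit of \<open>k\<close> is neither \<open>p - 1\<close> nor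
  \<open>2 * p - 1\<close>, so the increment causes no carry and does not cross
  \<open>p\<close>.\<close>

lemma gtm_word_Suc_eq:
  assumes "p > 0" "\<not> p dvd Suc k"
  shows "gtm_word p p (Suc k) = gtm_word p p k"
proof -
  define a b where "a = k div (2 * p)" and "b = k mod (2 * p)"
  have k: "k = (p + p) * a + b" and b: "b < p + p"
    using assms by (simp_all add: a_def b_def flip: mult_2)
  have "\<not> p dvd Suc b"
    using assms(2) k by (metis add_Suc_right dvd_add dvd_add_triv_left_iff dvd_mult2 dvd_refl)
  then have "Suc b \<noteq> p" "Suc b \<noteq> 2 * p"
    by auto
  then have "Suc b < p + p" "(p \<le> Suc b) = (p \<le> b)"
    using b by auto
  then show ?thesis
    using gtm_word_digit[of p p b a] gtm_word_digit[of p p "Suc b" a] assms(1) b k by simp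
qed

lemma thue_morse_Suc_neq:
  assumes "even k"
  shows "gtm_word 1 1 (Suc k) \<noteq> gtm_word 1 1 k"
proof -
  obtain j where "k = 2 * j"
    using assms by (rule evenE)
  then show ?thesis
    using gtm_word_digit[of 1 1 0 j] gtm_word_digit[of 1 1 1 j] by (simp add: mult_2)
qed

section \<open>From progressions to the maximal length\<close>

lemma has_mono_ap_mono: "has_mono_ap v d L \<Longrightarrow> L' \<le> L \<Longrightarrow> has_mono_ap v d L'"
  unfolding has_mono_ap_def by (meson order_less_le_trans)

text \<open>Attainable lengths are closed downwards, so one excluded length bounds them all; this
  also gives the finiteness that \<open>Max\<close> requires.\<close>

lemma A_eqI:
  assumes "L \<ge> 1" "has_mono_ap (gtm_word p q) d L" "\<not> has_mono_ap (gtm_word p q) d (Suc L)"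
  shows "A p q d = L"
proof -
  have "L' \<le> L" if "has_mono_ap (gtm_word p q) d L'" for L'
    using that assms(3) has_mono_ap_mono not_less_eq_eq by blast
  then have "{L. L \<ge> 1 \<and> has_mono_ap (gtm_word p q) d L} \<subseteq> {..L}"
    by auto
  then show ?thesis
    unfolding A_def using assms(1,2) finite_subset[OF _ finite_atMost]
    by (intro Max_eqI) auto
qed

section \<open>Even exponents: residues where the letter changes\<close>

locale even_block =
  fixes p n N e :: nat and v :: "nat \<Rightarrow> bool"
  assumes p: "p > 0" and n: "even n" "n > 1"
  defines "N \<equiv> (2 * p) ^ n"
  defines "e \<equiv> if p > 1 then p else 2"
  defines "v \<equiv> gtm_word p p"
begin

lemma N_ge: "2 * p * (2 * p) \<le> N"
proof -
  have "(2 * p) ^ 2 \<le> (2 * p) ^ n"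
    using n p by (intro power_increasing) auto
  then show ?thesis
    by (simp add: N_def power2_eq_square)
qed

lemma e_less: "0 < e" "e < N"
proof -
  have "2 * p * 2 \<le> 2 * p * (2 * p)"
    using p by (intro mult_left_mono) auto
  from order_trans[OF this N_ge] have "4 * p \<le> N"
    by simp
  then show "e < N"
    using p by (simp add: e_def)
  show "0 < e"
    by (simp add: e_def)
qed

lemma v_0: "\<not> v 0"
  unfolding v_def by (rule gtm_word_0[OF p p])

lemma v_block: "r < N \<Longrightarrow> v (k * N + r) = (v k \<noteq> v r)"
  unfolding v_def N_def using gtm_word_block[OF p p, of r n k] by (simp flip: mult_2)

lemma v_reflect: "r < N \<Longrightarrow> v (N - 1 - r) = v r"
  unfolding v_def N_def using gtm_word_reflect[OF p, of r n] n by simp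

lemma v_digit: "r < 2 * p \<Longrightarrow> v r = (p \<le> r)"
  unfolding v_def using gtm_word_digit[of p p r 0] gtm_word_0[OF p p] p by simp

lemma v_Thue_Morse: "\<not> p > 1 \<Longrightarrow> \<not> v 0 \<and> v 1 \<and> v 2 \<and> \<not> v 3 \<and> v 4"
proof -
  assume "\<not> p > 1"
  then have [simp]: "p = 1"
    using p by simp
  have d: "r < 2 \<Longrightarrow> v (2 * k + r) = (v k \<noteq> (1 \<le> r))" for k r
    unfolding v_def using gtm_word_digit[of 1 1 r k] by (simp add: mult_2)
  show ?thesis
    using v_0 d[of 1 0] d[of 0 1] d[of 1 1] d[of 0 2] by simp
qed

text \<open>The condition on the last digit of \<open>k\<close> that fixes how \<open>v k\<close>
  and \<open>v (Suc k)\<close> compare: equal if \<open>p > 1\<close>, distinct if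
  \<open>p = 1\<close>.\<close>

definition regular :: "nat \<Rightarrow> bool" where
  "regular k \<longleftrightarrow> (if p > 1 then \<not> p dvd Suc k else even k)"

text \<open>The choice of \<open>e\<close> is made for this: \<open>v\<close> changes from
  \<open>e - 1\<close> to \<open>e\<close> if \<open>p > 1\<close>, whereas \<open>v 1 = v 2\<close>
  if \<open>p = 1\<close>.\<close>

lemma regular_change:
  assumes "regular k"
  shows "(v k = v (Suc k)) = (v (e - 1) \<noteq> v e)"
proof (cases "p > 1")
  case True
  then show ?thesis
    using assms gtm_word_Suc_eq[OF p, of k] v_digit[of p] v_digit[of "p - 1"]
    by (simp add: regular_def e_def v_def)
next
  case False
  then have "p = 1"
    using p by simp
  moreover have "even k"
    using assms False by (simp add: regular_def)
  ultimately show ?thesis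
    using thue_morse_Suc_neq[of k] v_Thue_Morse by (auto simp: e_def v_def)
qed

lemma change_high:
  assumes "regular k"
  shows "v (k * N + (N - e)) \<noteq> v (k * N + (N - e) + (N - 1))"
proof -
  have eq: "k * N + (N - e) + (N - 1) = Suc k * N + (N - 1 - e)"
    using e_less by simp
  have 1: "v (N - e) = v (e - 1)" "v (N - 1 - e) = v e"
    using v_reflect[of "e - 1"] v_reflect[of e] e_less by simp_all
  show ?thesis
    unfolding eq using v_block[of "N - e" k] v_block[of "N - 1 - e" "Suc k"] e_less
      regular_change[OF assms] 1 by auto
qed

lemma change_low:
  assumes "regular k"
  shows "v (k * N + e) \<noteq> v (k * N + e + (N - 1))"
proof -
  have eq: "k * N + e + (N - 1) = Suc k * N + (e - 1)"
    using e_less by simp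
  show ?thesis
    unfolding eq using v_block[of e k] v_block[of "e - 1" "Suc k"] e_less
      regular_change[OF assms] by auto
qed

text \<open>Both values of \<open>c\<close> are -1 modulo \<open>p\<close> (odd if
  \<open>p = 1\<close>), which moves an irregular \<open>k\<close> out of its residue class. They
  are the block distances between the two changes compared in \<open>upper\<close>.\<close>

lemma regular_shift:
  assumes "\<not> regular k" "c = 2 * e - 1 \<or> c = N - 1"
  shows "regular (k + c)"
proof (cases "p > 1")
  case True
  have "p dvd N"
    using n by (simp add: N_def dvd_power_same)
  then have "p dvd Suc c"
    using assms(2) e_less True by (auto simp: e_def)
  moreover have "p dvd Suc k"
    using assms True by (simp add: regular_def)
  ultimately have "p dvd Suc (k + c) + 1"
    using dvd_add[of p "Suc k" "Suc c"] by simp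
  then have "\<not> p dvd Suc (k + c)"
    using True dvd_add_right_iff[of p "Suc (k + c)" 1] by auto
  then show ?thesis
    using True by (simp add: regular_def)
next
  case False
  then have "even N"
    using n by (simp add: N_def)
  then have "odd c"
    using assms(2) e_less by auto
  then show ?thesis
    using assms False by (simp add: regular_def)
qed

section \<open>Even exponents: the two bounds\<close>

lemma upper: "\<not> has_mono_ap v (N - 1) (Suc (N + 2 * e))"
proof
  assume "has_mono_ap v (N - 1) (Suc (N + 2 * e))"
  then obtain i where i: "\<And>j. j < Suc (N + 2 * e) \<Longrightarrow> v (i + j * (N - 1)) = v i"
    unfolding has_mono_ap_def by blast
  have same: "v (i + j * (N - 1)) = v (i + j * (N - 1) + (N - 1))" if "j < N + 2 * e" for j
  proof -
    have "i + Suc j * (N - 1) = i + j * (N - 1) + (N - 1)"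
      by simp
    then show ?thesis
      using i[of j] i[of "Suc j"] that by (simp only: Suc_less_eq less_SucI)
  qed
  define x y where "x = i mod N" and "y = i div N"
  have i_eq: "i = y * N + x" and x: "x < N"
    using e_less by (simp_all add: x_def y_def)
  obtain M where M: "N = Suc M" "e \<le> M"
    using e_less by (cases N) auto
  \<comment> \<open>Each step advances one block and lowers the residue by one. After
    \<open>x + e\<close> steps the residue has wrapped to \<open>N - e\<close>, and every further
    \<open>N\<close> steps return to it \<open>N - 1\<close> blocks later.\<close>
  have high: "i + (x + e + m * N) * (N - 1) = (y + x + e - 1 + m * (N - 1)) * N + (N - e)" for m
  proof -
    obtain e' where "e = Suc e'" using e_less by (cases e) auto
    then show ?thesis using M by (simp add: i_eq algebra_simps)
  qed
  have h: "\<not> regular (y + x + e - 1 + m * (N - 1))" if "x + e + m * N < N + 2 * e" for m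
    using change_high same[OF that] unfolding high by blast
  show False
  proof (cases "x \<ge> e")
    case True
    then obtain u where u: "x = e + u"
      using le_Suc_ex by blast
    \<comment> \<open>Before wrapping, the progression passes residue \<open>e\<close> at term
      \<open>u\<close>; residue \<open>N - e\<close> follows \<open>2 * e - 1\<close> blocks
      later.\<close>
    have low: "i + u * (N - 1) = (y + u) * N + e"
      using M by (simp add: i_eq u algebra_simps)
    have "\<not> regular (y + u)"
      using change_low[of "y + u"] same[of u] x unfolding low by (auto simp: u)
    from regular_shift[OF this, of "2 * e - 1"] have "regular (y + u + (2 * e - 1))"
      by simp
    moreover have "y + u + (2 * e - 1) = y + x + e - 1"
      using e_less by (simp add: u)
    ultimately show False
      using h[of 0] x e_less by simp
  next
    case False
    \<comment> \<open>For \<open>x < e\<close> even the second visit to residue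
      \<open>N - e\<close>, at term \<open>x + e + N\<close>, has a successor within the
      progression.\<close>
    then have "\<not> regular (y + x + e - 1)"
      using h[of 0] x e_less by simp
    then show False
      using regular_shift[of "y + x + e - 1" "N - 1"] h[of 1] False by simp
  qed
qed

text \<open>The middle \<open>N\<close> terms form a sweep whose letters are all \<open>v k\<close>.
  The \<open>e\<close> terms before and after it meet the blocks next to the multiples
  \<open>k * N\<close> and \<open>(k + 1) * N\<close>, where \<open>nb\<close> supplies the
  agreement.\<close>

lemma lower_if:
  assumes k: "k > 0"
    and nb: "\<And>u. 0 < u \<Longrightarrow> u < e \<Longrightarrow>
      (v (k - 1) \<noteq> (v (u - 1) \<noteq> v u)) = v k \<and> (v (k + 1) \<noteq> (v (u - 1) \<noteq> v u)) = v k"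
  shows "has_mono_ap v (N - 1) (N + 2 * e)"
proof -
  obtain k' where k': "k = Suc k'"
    using k by (cases k) auto
  obtain M where M: "N = Suc M"
    using e_less by (cases N) auto
  \<comment> \<open>The start is chosen so that term \<open>e - 1\<close> has residue
    \<open>0\<close> in block \<open>k * N\<close>, and the full sweep begins in that block at
    residue \<open>N - 1\<close>.\<close>
  define i where "i = (k * N - (e - 1)) * N + (e - 1)"
  have "N \<le> k * N"
    using k by simp
  then have e_kN: "e < k * N"
    using e_less by linarith
  have "v (i + j * (N - 1)) = v k" if j: "j < N + 2 * e" for j
  proof -
    consider "j < e" | "e \<le> j" "j < e + N" | "e + N \<le> j"
      by linarith
    then show ?thesis
    proof cases
      case 1
      define u where "u = e - 1 - j"
      have u: "u < e" "e = Suc (u + j)"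
        using 1 by (auto simp: u_def)
      \<comment> \<open>Additive witnesses such as \<open>z\<close> eliminate truncated subtraction,
        so that \<open>algebra_simps\<close> can verify the position.\<close>
      obtain z where z: "k * N = (u + j) + z"
        using e_kN u le_Suc_ex[of "u + j" "k * N"] by auto
      have "i + j * (N - 1) = (k * N - u) * N + u"
        unfolding i_def z u(2) by (simp add: M algebra_simps)
      then have "v (i + j * (N - 1)) = (v (k * N - u) \<noteq> v u)"
        using v_block[of u] u e_less by simp
      also have "\<dots> = v k"
      proof (cases u)
        case 0
        then show ?thesis
          using v_block[of 0 k] v_0 e_less by simp
      next
        case (Suc u')
        have "k * N - u = k' * N + (N - 1 - u')"
          using Suc u e_less by (simp add: k')
        then have "v (k * N - u) = (v k' \<noteq> v u')"
          using v_block[of "N - 1 - u'" k'] v_reflect[of u'] Suc u e_less by simp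
        then show ?thesis
          using nb[of u] Suc u k' by auto
      qed
      finally show ?thesis .
    next
      case 2
      define t where "t = j - e"
      have t: "j = e + t" "t < N"
        using 2 by (auto simp: t_def)
      obtain z where z: "k * N = (e - 1) + z"
        using e_kN le_Suc_ex[of "e - 1" "k * N"] less_imp_diff_less less_imp_le by blast
      obtain e' where e': "e = Suc e'"
        using e_less by (cases e) auto
      obtain s where s: "M = t + s"
        using t(2) M le_Suc_ex[of t M] by auto
      \<comment> \<open>The block contributes \<open>v k\<close> and \<open>v t\<close>, the residue
        contributes \<open>v t\<close> by reflection, and the two copies of \<open>v t\<close>
        cancel.\<close>
      have "i + j * (N - 1) = (k * N + t) * N + (N - 1 - t)"
        unfolding i_def z t e' by (simp add: M s algebra_simps)
      then show ?thesis
        using v_block[of "N - 1 - t" "k * N + t"] v_block[of t k] v_reflect[of t] t by auto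
    next
      case 3
      define u where "u = j - (e + N)"
      have u: "j = e + N + u" "u < e"
        using 3 j by (auto simp: u_def)
      obtain z where z: "k * N = (e - 1) + z"
        using e_kN le_Suc_ex[of "e - 1" "k * N"] less_imp_diff_less less_imp_le by blast
      obtain e' where e': "e = Suc e'"
        using e_less by (cases e) auto
      obtain s where s: "M = u + s"
        using u(2) e_less M le_Suc_ex[of u M] by auto
      have "i + j * (N - 1) = (k * N + (N - 1) + u) * N + (N - 1 - u)"
        unfolding i_def z u(1) e' by (simp add: M s algebra_simps)
      then have *: "v (i + j * (N - 1)) = (v (k * N + (N - 1) + u) \<noteq> v u)"
        using v_block[of "N - 1 - u" "k * N + (N - 1) + u"] v_reflect[of u] u e_less by auto
      show ?thesis
      proof (cases u)
        case 0
        then show ?thesis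
          using * v_block[of "N - 1" k] v_reflect[of 0] v_0 e_less by simp
      next
        case (Suc u')
        have "k * N + (N - 1) + u = Suc k * N + u'"
          using Suc M by simp
        with * have "v (i + j * (N - 1)) = (v (Suc k * N + u') \<noteq> v u)"
          by (simp only:)
        moreover have "v (Suc k * N + u') = (v (Suc k) \<noteq> v u')"
          using Suc u e_less by (intro v_block) simp
        ultimately have "v (i + j * (N - 1)) = ((v (k + 1) \<noteq> v u') \<noteq> v u)"
          by simp
        then show ?thesis
          using nb[of u] Suc u by auto
      qed
    qed
  qed
  moreover from this[of 0] have "v i = v k"
    using e_less by simp
  ultimately show ?thesis
    unfolding has_mono_ap_def by blast
qed

lemma lower: "has_mono_ap v (N - 1) (N + 2 * e)"
proof (cases "p > 1")
  case True
  have d: "r < 2 * p \<Longrightarrow> v (2 * p * k + r) = (v k \<noteq> (p \<le> r))" for k r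
    unfolding v_def using gtm_word_digit[OF p p, of r k] by (simp flip: mult_2)
  \<comment> \<open>The witness \<open>k = p * (2 * p)\<close> has digits \<open>p, 0\<close>; its
    neighbours end in \<open>p - 1, 2 * p - 1\<close> and \<open>p, 1\<close>. All three letters are
    1, while \<open>v\<close> is constant below \<open>p\<close>.\<close>
  have v: "v (p * (2 * p))" "v (p * (2 * p) + 1)"
    using d[of 0 p] d[of 1 p] v_digit[of p] True by (simp_all add: mult.commute)
  have "p * (2 * p) - 1 = 2 * p * (p - 1) + (2 * p - 1)"
    using True by (cases p) auto
  moreover have "v (2 * p * (p - 1) + (2 * p - 1))"
    using d[of "2 * p - 1" "p - 1"] v_digit[of "p - 1"] True by fastforce
  ultimately have "v (p * (2 * p) - 1)"
    by (simp only:)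
  then show ?thesis
    using True v v_digit by (intro lower_if[of "p * (2 * p)"]) (auto simp: e_def)
next
  case False
  show ?thesis
  \<comment> \<open>Only \<open>u = 1\<close> occurs, with \<open>v 0\<close> and \<open>v 1\<close>
    distinct, so both neighbours of \<open>k\<close> must carry the other letter:
    \<open>v 2\<close>, \<open>v 3\<close>, \<open>v 4\<close> are 1, 0, 1.\<close>
  proof (rule lower_if[of 3])
    fix u assume "0 < u" "u < e"
    then have "u = 1"
      using False by (simp add: e_def)
    then show "(v (3 - 1) \<noteq> (v (u - 1) \<noteq> v u)) = v 3 \<and>
        (v (3 + 1) \<noteq> (v (u - 1) \<noteq> v u)) = v 3"
      using v_Thue_Morse[OF False] by simp
  qed simp
qed

end

section \<open>Odd exponents\<close>

lemma odd_block:
  assumes p: "p > 0" and n: "odd n"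
  defines "N \<equiv> (2 * p) ^ n"
  shows "has_mono_ap (gtm_word p p) (N - 1) N" "\<not> has_mono_ap (gtm_word p p) (N - 1) (Suc N)"
proof -
  let ?v = "gtm_word p p"
  have block: "?v (k * N + r) = (?v k \<noteq> ?v r)" if "r < N" for k r
    unfolding N_def using gtm_word_block[OF p p, of r n k] that by (simp add: N_def flip: mult_2)
  have reflect: "?v (N - 1 - r) = (\<not> ?v r)" if "r < N" for r
    using gtm_word_reflect[OF p, of r n] that n by (simp add: N_def)
  obtain M where M: "N = Suc M"
    using p by (cases N) (auto simp: N_def)
  \<comment> \<open>Starting at \<open>N - 1\<close>, term \<open>j\<close> pairs block
    \<open>j\<close> with the reflection of \<open>j\<close>, whose letter is opposite; every letter
    is therefore 1.\<close>
  have "?v (N - 1 + j * (N - 1))" if j: "j < N" for j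
  proof -
    obtain s where s: "M = j + s"
      using j M le_Suc_ex[of j M] by auto
    have "N - 1 + j * (N - 1) = j * N + (N - 1 - j)"
      by (simp add: M s algebra_simps)
    then show ?thesis
      using block[of "N - 1 - j" j] reflect[OF j] j by simp
  qed
  from this this[of 0] show "has_mono_ap ?v (N - 1) N"
    unfolding has_mono_ap_def using M by (intro exI[of _ "N - 1"]) auto
  show "\<not> has_mono_ap ?v (N - 1) (Suc N)"
  proof
    assume "has_mono_ap ?v (N - 1) (Suc N)"
    then obtain i where i: "\<And>j. j < Suc N \<Longrightarrow> ?v (i + j * (N - 1)) = ?v i"
      unfolding has_mono_ap_def by blast
    define x y where "x = i mod N" and "y = i div N"
    have i_eq: "i = y * N + x"
      by (simp add: x_def y_def)
    have x: "x < N"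
      by (simp add: x_def M)
    \<comment> \<open>Term \<open>x\<close> reaches residue \<open>0\<close>; the next term is the
      last position of the same block, where reflection gives the opposite letter.\<close>
    have "i + x * (N - 1) = (y + x) * N + 0" "i + Suc x * (N - 1) = (y + x) * N + (N - 1)"
      by (simp_all add: i_eq M algebra_simps)
    then have "?v ((y + x) * N + 0) = ?v ((y + x) * N + (N - 1))"
      using i[of x] i[of "Suc x"] x by simp
    then show False
      using block[of 0 "y + x"] block[of "N - 1" "y + x"] reflect[of 0] x by auto
  qed
qed

theorem proposition28:
  fixes n p Q :: nat
  assumes "n > 1" and "p > 0" and "Q = 2 * p"
  shows "A p p (Q ^ n - 1) =
    (if odd n then Q ^ n
     else if p > 1 then Q ^ n + Q
     else Q ^ n + Q + 2)"
proof (cases "odd n")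
  case True
  have "1 \<le> Q ^ n"
    using assms by simp
  with True show ?thesis
    using A_eqI odd_block[OF assms(2) True] assms(3) by simp
next
  case False
  interpret even_block p n "(2 * p) ^ n" "if p > 1 then p else 2" "gtm_word p p"
    using assms False by unfold_locales auto
  have "A p p ((2 * p) ^ n - 1) = (2 * p) ^ n + 2 * (if p > 1 then p else 2)"
    using assms by (intro A_eqI upper lower) auto
  with False assms show ?thesis
    by auto
qed

end
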